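(* Let $S,\Sigma\subset\Omega$ be measurable with $0<\mu(S),\mu(\Sigma)<\infty$. Let $\phi=\psi$ be the function on $\Omega$ defined by $\phi=\frac{1}{\sqrt{\mu(S)}}\chi_S$ and let $\sigma=\chi_\Sigma$. Then $$L_{S,\Sigma}=\mu(S)\,P_{\Sigma,\phi}.$$
   Context: Setting: $\Omega\subset\mathbb{R}^d$ is a convex cone ($\lambda x\in\Omega$ for all $\lambda>0$, $x\in\Omega$) with non-empty interior, endowed with a Borel measure $\mu$, absolutely continuous with respect to Lebesgue measure, with polar decomposition $d\mu(r\zeta)=r^{2a-1}\,dr\,Q(\zeta)\,d\omega(\zeta)$, where $a>0$, $d\omega$ is the surface measure on the unit sphere $\mathbb{S}^{d-1}$, and $Q\in L^1(\mathbb{S}^{d-1},d\omega)$, $Q\ne 0$ (so $\mu$ is homogeneous of degree $2a$). $\langle f,g\rangle_\mu=\int_\Omega f\overline{g}\,d\mu$ is the inner product of $L^2(\Omega,\mu)$. The kernel $\mathcal{K}:\Omega\times\Omega\to\mathbb{C}$ is continuous, bounded ($|\mathcal{K}(x,\xi)|\le c_{\mathcal{K}}$) and homogeneous ($\mathcal{K}(\lambda x,\xi)=\mathcal{K}(x,\lambda\xi)$ for $\lambda>0$). The operator $\mathcal{T}$ is $\mathcal{T}f(\xi)=\int_\Omega f(x)\mathcal{K}(x,\xi)\,d\mu(x)$. It is assumed that (i) (inversion) if $f,\mathcal{T}f\in L^1(\Omega,\mu)$ then $f$ is continuous and $f(x)=\int_\Omega\mathcal{T}f(\xi)\overline{\mathcal{K}(x,\xi)}\,d\mu(\xi)$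 for almost every $x$; (ii) (Parseval) $\langle\mathcal{T}f,\mathcal{T}g\rangle_\mu=\langle f,g\rangle_\mu$ for Schwartz functions $f,g$ on $\Omega$; in particular $\mathcal{T}$ extends to a unitary operator of $L^2(\Omega,\mu)$ onto itself, with $\mathcal{T}^{-1}f=\overline{\mathcal{T}\overline{f}}$. For measurable $A\subset\Omega$, $E_Af=\chi_Af$ and $F_Af=\mathcal{T}^{-1}[\chi_A\mathcal{T}f]$ on $L^2(\Omega,\mu)$; $L_{S,\Sigma}=E_SF_\Sigma E_S$. For a symbol $\sigma$ and $\phi,\psi\in L^2(\Omega,\mu)\cap L^\infty(\Omega,\mu)$ of $L^2$ norm $1$, $P_{\sigma,\phi,\psi}$ is the operator on $L^2(\Omega,\mu)$ defined by $\langle P_{\sigma,\phi,\psi}f,g\rangle_\mu=\langle\sigma\mathcal{T}(\phi f),\mathcal{T}(\psi g)\rangle_\mu$ for all $f,g\in L^2(\Omega,\mu)$; $P_{\Sigma,\phi}$ denotes $P_{\chi_\Sigma,\phi,\phi}$. *)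

theory Defs
  imports "HOL-Analysis.Analysis"
begin

section \<open>The space of square integrable functions\<close>

text \<open>Elements of \<open>L\<^sup>2(M)\<close> are represented by functions, and equality in \<open>L\<^sup>2(M)\<close> is
  equality almost everywhere. An operator is a map on representatives.\<close>

definition L2 :: "'a measure \<Rightarrow> ('a \<Rightarrow> complex) set" where
  "L2 M = {f \<in> borel_measurable M. integrable M (\<lambda>x. (cmod (f x))\<^sup>2)}"

definition inner_L2 :: "'a measure \<Rightarrow> ('a \<Rightarrow> complex) \<Rightarrow> ('a \<Rightarrow> complex) \<Rightarrow> complex" where
  "inner_L2 M f g = (\<integral>x. f x * cnj (g x) \<partial>M)"

definition eq_op_L2 ::
  "'a measure \<Rightarrow> (('a \<Rightarrow> complex) \<Rightarrow> 'a \<Rightarrow> complex) \<Rightarrow> (('a \<Rightarrow> complex) \<Rightarrow> 'a \<Rightarrow> complex) \<Rightarrow> bool" where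
  "eq_op_L2 M A B \<longleftrightarrow> (\<forall>f \<in> L2 M. A f \<in> L2 M \<and> B f \<in> L2 M \<and> (AE x in M. A f x = B f x))"

text \<open>The first two clauses say that \<open>U\<close> induces a map on equivalence classes.\<close>

definition unitary_L2 :: "'a measure \<Rightarrow> (('a \<Rightarrow> complex) \<Rightarrow> 'a \<Rightarrow> complex) \<Rightarrow> bool" where
  "unitary_L2 M U \<longleftrightarrow>
     (\<forall>f \<in> L2 M. U f \<in> L2 M) \<and>
     (\<forall>f \<in> L2 M. \<forall>g \<in> L2 M. (AE x in M. f x = g x) \<longrightarrow> (AE x in M. U f x = U g x)) \<and>
     (\<forall>f \<in> L2 M. \<forall>g \<in> L2 M. \<forall>c d. AE x in M. U (\<lambda>y. c * f y + d * g y) x = c * U f x + d * U g x) \<and>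
     (\<forall>f \<in> L2 M. \<forall>g \<in> L2 M. inner_L2 M (U f) (U g) = inner_L2 M f g) \<and>
     (\<forall>h \<in> L2 M. \<exists>f \<in> L2 M. AE x in M. U f x = h x)"

text \<open>The inverse of a unitary operator; the choice is unique up to a null set.\<close>

definition inv_L2 ::
  "'a measure \<Rightarrow> (('a \<Rightarrow> complex) \<Rightarrow> 'a \<Rightarrow> complex) \<Rightarrow> ('a \<Rightarrow> complex) \<Rightarrow> 'a \<Rightarrow> complex" where
  "inv_L2 M U h = (SOME f. f \<in> L2 M \<and> (AE x in M. U f x = h x))"

section \<open>Schwartz functions\<close>

definition partial_deriv ::
  "'a::euclidean_space \<Rightarrow> ('a \<Rightarrow> complex) \<Rightarrow> 'a \<Rightarrow> complex" where
  "partial_deriv b f x = frechet_derivative f (at x) b"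

text \<open>A multi-index is given as a list of basis vectors. Differentiability of all iterated partial
  derivatives is the same as being infinitely often differentiable.\<close>

definition schwartz :: "('a::euclidean_space \<Rightarrow> complex) \<Rightarrow> bool" where
  "schwartz f \<longleftrightarrow>
     (\<forall>bs. set bs \<subseteq> Basis \<longrightarrow>
        (\<forall>x. foldr partial_deriv bs f differentiable (at x)) \<and>
        (\<forall>k::nat. bounded (range (\<lambda>x. norm x ^ k *\<^sub>R foldr partial_deriv bs f x))))"

text \<open>Schwartz functions on a subset are the restrictions of Schwartz functions on the whole space.\<close>

definition schwartz_on :: "'a::euclidean_space set \<Rightarrow> ('a \<Rightarrow> complex) \<Rightarrow> bool" where
  "schwartz_on \<Omega> f \<longleftrightarrow> (\<exists>g. schwartz g \<and> (\<forall>x \<in> \<Omega>. f x = g x))"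

section \<open>Polar decomposition\<close>

text \<open>The surface measure of a Borel subset \<open>B\<close> of the unit sphere is \<open>d\<close> times the volume of
  the part of the unit ball lying over \<open>B\<close>. Note that \<open>sgn x = x /\<^sub>R norm x\<close>.\<close>

definition surface_measure :: "'a::euclidean_space measure" where
  "surface_measure =
     scale_measure (of_nat DIM('a))
       (distr (restrict_space lborel (ball 0 1 - {0})) (restrict_space borel (sphere 0 1)) sgn)"

text \<open>The completion is needed because a convex cone, hence a set in \<open>sets \<mu>\<close> below, need not be a
  Borel subset of the whole space: its trace on the sphere is Borel only up to a null set.\<close>

definition has_polar_decomposition ::
  "'a::euclidean_space measure \<Rightarrow> real \<Rightarrow> ('a \<Rightarrow> real) \<Rightarrow> bool" where
  "has_polar_decomposition \<mu> a Q \<longleftrightarrow>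
     (\<forall>A \<in> sets \<mu>. emeasure \<mu> A =
        (\<integral>\<^sup>+\<zeta>. (\<integral>\<^sup>+r. indicator {0<..} r * indicator A (r *\<^sub>R \<zeta>) * ennreal (r powr (2 * a - 1)) \<partial>lborel)
               * ennreal (Q \<zeta>) \<partial>completion surface_measure))"

section \<open>The integral operator\<close>

definition integral_op ::
  "'a measure \<Rightarrow> ('a \<Rightarrow> 'a \<Rightarrow> complex) \<Rightarrow> ('a \<Rightarrow> complex) \<Rightarrow> 'a \<Rightarrow> complex" where
  "integral_op \<mu> K f \<xi> = (\<integral>x. f x * K x \<xi> \<partial>\<mu>)"

text \<open>\<open>\<T>\<close> is the extension to \<open>L\<^sup>2(\<Omega>, \<mu>)\<close> of the integral operator with kernel \<open>K\<close>. Its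
  surjectivity and the formula for its inverse are standing assumptions on their own: they do not
  follow from the inversion formula and Parseval's identity. For instance, the suitably normalized kernel
  \<open>exp (- \<i> \<langle>x, \<tau> \<xi>\<rangle>)\<close> on the plane, with \<open>\<tau>\<close> doubling the polar angle, satisfies both, but its
  extension is not onto.\<close>

locale unitary_integral_operator =
  fixes \<Omega> :: "'a::euclidean_space set"
    and \<mu> :: "'a measure"
    and a :: real
    and Q :: "'a \<Rightarrow> real"
    and K :: "'a \<Rightarrow> 'a \<Rightarrow> complex"
    and \<T> :: "('a \<Rightarrow> complex) \<Rightarrow> 'a \<Rightarrow> complex"
  assumes convex: "convex \<Omega>"
    and cone: "\<And>x t. x \<in> \<Omega> \<Longrightarrow> t > 0 \<Longrightarrow> t *\<^sub>R x \<in> \<Omega>"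
    and interior: "interior \<Omega> \<noteq> {}"
    and space_measure: "space \<mu> = \<Omega>"
    and borel_measure: "sets \<mu> = sets (restrict_space borel \<Omega>)"
    and absolutely_continuous: "\<And>A. A \<in> sets \<mu> \<Longrightarrow> A \<in> null_sets lebesgue \<Longrightarrow> A \<in> null_sets \<mu>"
    and a_pos: "a > 0"
    and Q_integrable: "integrable surface_measure Q"
    and Q_nonneg: "AE \<zeta> in surface_measure. \<zeta> \<in> \<Omega> \<longrightarrow> 0 \<le> Q \<zeta>"
    and Q_nonzero: "\<not> (AE \<zeta> in surface_measure. Q \<zeta> = 0)"
    and polar: "has_polar_decomposition \<mu> a Q"
    and kernel_continuous: "continuous_on (\<Omega> \<times> \<Omega>) (\<lambda>(x, \<xi>). K x \<xi>)"
    and kernel_bounded: "bounded ((\<lambda>(x, \<xi>). K x \<xi>) ` (\<Omega> \<times> \<Omega>))"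
    and kernel_homogeneous:
      "\<And>x \<xi> t. x \<in> \<Omega> \<Longrightarrow> \<xi> \<in> \<Omega> \<Longrightarrow> t > 0 \<Longrightarrow> K (t *\<^sub>R x) \<xi> = K x (t *\<^sub>R \<xi>)"
    and inversion_continuous:
      "\<And>f. integrable \<mu> f \<Longrightarrow> integrable \<mu> (integral_op \<mu> K f) \<Longrightarrow>
         \<exists>g. continuous_on \<Omega> g \<and> (AE x in \<mu>. f x = g x)"
    and inversion:
      "\<And>f. integrable \<mu> f \<Longrightarrow> integrable \<mu> (integral_op \<mu> K f) \<Longrightarrow>
         AE x in \<mu>. f x = (\<integral>\<xi>. integral_op \<mu> K f \<xi> * cnj (K x \<xi>) \<partial>\<mu>)"
    and Parseval:
      "\<And>f g. schwartz_on \<Omega> f \<Longrightarrow> schwartz_on \<Omega> g \<Longrightarrow>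
         inner_L2 \<mu> (integral_op \<mu> K f) (integral_op \<mu> K g) = inner_L2 \<mu> f g"
    and extends: "\<And>f. f \<in> L2 \<mu> \<Longrightarrow> integrable \<mu> f \<Longrightarrow> AE \<xi> in \<mu>. \<T> f \<xi> = integral_op \<mu> K f \<xi>"
    and unitary: "unitary_L2 \<mu> \<T>"
    and inverse: "\<And>f. f \<in> L2 \<mu> \<Longrightarrow> AE x in \<mu>. inv_L2 \<mu> \<T> f x = cnj (\<T> (\<lambda>y. cnj (f y)) x)"

section \<open>Localization operators\<close>

definition E_op :: "'a set \<Rightarrow> ('a \<Rightarrow> complex) \<Rightarrow> 'a \<Rightarrow> complex" where
  "E_op A f x = indicator A x * f x"

definition F_op ::
  "'a measure \<Rightarrow> (('a \<Rightarrow> complex) \<Rightarrow> 'a \<Rightarrow> complex) \<Rightarrow> 'a set \<Rightarrow> ('a \<Rightarrow> complex) \<Rightarrow> 'a \<Rightarrow> complex" where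
  "F_op \<mu> \<T> A f = inv_L2 \<mu> \<T> (\<lambda>\<xi>. indicator A \<xi> * \<T> f \<xi>)"

definition L_op ::
  "'a measure \<Rightarrow> (('a \<Rightarrow> complex) \<Rightarrow> 'a \<Rightarrow> complex) \<Rightarrow> 'a set \<Rightarrow> 'a set \<Rightarrow> ('a \<Rightarrow> complex) \<Rightarrow> 'a \<Rightarrow> complex" where
  "L_op \<mu> \<T> S \<Sigma> f = E_op S (F_op \<mu> \<T> \<Sigma> (E_op S f))"

text \<open>The operator defined weakly by the sesquilinear form
  \<open>(f, g) \<mapsto> \<langle>\<sigma> \<T>(\<phi> f), \<T>(\<psi> g)\<rangle>\<close>; the choice is unique up to a null set.\<close>

definition P_op ::
  "'a measure \<Rightarrow> (('a \<Rightarrow> complex) \<Rightarrow> 'a \<Rightarrow> complex) \<Rightarrow> ('a \<Rightarrow> complex) \<Rightarrow> ('a \<Rightarrow> complex) \<Rightarrow> ('a \<Rightarrow> complex)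
     \<Rightarrow> ('a \<Rightarrow> complex) \<Rightarrow> 'a \<Rightarrow> complex" where
  "P_op \<mu> \<T> \<sigma> \<phi> \<psi> f = (SOME h. h \<in> L2 \<mu> \<and>
     (\<forall>g \<in> L2 \<mu>. inner_L2 \<mu> h g =
        inner_L2 \<mu> (\<lambda>\<xi>. \<sigma> \<xi> * \<T> (\<lambda>x. \<phi> x * f x) \<xi>) (\<T> (\<lambda>x. \<psi> x * g x))))"

definition P_set_op ::
  "'a measure \<Rightarrow> (('a \<Rightarrow> complex) \<Rightarrow> 'a \<Rightarrow> complex) \<Rightarrow> 'a set \<Rightarrow> ('a \<Rightarrow> complex)
     \<Rightarrow> ('a \<Rightarrow> complex) \<Rightarrow> 'a \<Rightarrow> complex" where
  "P_set_op \<mu> \<T> \<Sigma> \<phi> = P_op \<mu> \<T> (indicator \<Sigma>) \<phi> \<phi>"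

end

theory Submission
  imports Defs
begin

text \<open>Since \<open>\<T>\<close> is unitary and \<open>E\<^sub>S\<close> is a self-adjoint projection,
  \<open>\<langle>L\<^sub>S\<^sub>,\<^sub>\<Sigma> f, g\<rangle> = \<langle>\<chi>\<^sub>\<Sigma> \<T>(\<chi>\<^sub>S f), \<T>(\<chi>\<^sub>S g)\<rangle>\<close>. The two factors
  \<open>1 / sqrt (\<mu>(S))\<close> contributed by \<open>\<phi>\<close> turn the right-hand side into \<open>\<mu>(S) \<langle>P f, g\<rangle>\<close>, and
  an element of \<open>L\<^sup>2\<close> is determined by its inner products.\<close>

lemma L2_measurable: "f \<in> L2 M \<Longrightarrow> f \<in> borel_measurable M"
  by (simp add: L2_def)

lemma L2_integrable_power2: "f \<in> L2 M \<Longrightarrow> integrable M (\<lambda>x. (cmod (f x))\<^sup>2)"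
  by (simp add: L2_def)

lemma borel_measurable_cnj [measurable]: "cnj \<in> borel_measurable borel"
  by (intro borel_measurable_continuous_onI continuous_intros)

text \<open>From \<open>s * t \<le> s\<^sup>2 + t\<^sup>2\<close> with \<open>s\<close>,
  \<open>t\<close> the moduli. It makes additivity of the integral available for
  \<open>inner_L2\<close>; a non-integrable integrand would give the default value 0.\<close>

lemma L2_integrable_mult_cnj:
  assumes f: "f \<in> L2 M" and g: "g \<in> L2 M"
  shows "integrable M (\<lambda>x. f x * cnj (g x))"
proof (rule Bochner_Integration.integrable_bound)
  show "integrable M (\<lambda>x. (cmod (f x))\<^sup>2 + (cmod (g x))\<^sup>2)"
    using f g by (simp add: L2_integrable_power2)
  have [measurable]: "f \<in> borel_measurable M" "g \<in> borel_measurable M"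
    using f g by (auto intro: L2_measurable)
  show "(\<lambda>x. f x * cnj (g x)) \<in> borel_measurable M"
    by measurable
  have "s * t \<le> s\<^sup>2 + t\<^sup>2" if "0 \<le> s" "0 \<le> t" for s t :: real
    using sum_squares_bound[of s t] that mult_nonneg_nonneg[OF that] by linarith
  then show "AE x in M. norm (f x * cnj (g x)) \<le> norm ((cmod (f x))\<^sup>2 + (cmod (g x))\<^sup>2)"
    by (simp add: norm_mult)
qed

lemma L2_cmult: "f \<in> L2 M \<Longrightarrow> (\<lambda>x. c * f x) \<in> L2 M"
  by (auto simp: L2_def norm_mult power_mult_distrib)

lemma L2_add:
  assumes f: "f \<in> L2 M" and g: "g \<in> L2 M"
  shows "(\<lambda>x. f x + g x) \<in> L2 M"
proof -
  have [measurable]: "f \<in> borel_measurable M" "g \<in> borel_measurable M"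
    using f g by (auto intro: L2_measurable)
  have bound: "(cmod (z + w))\<^sup>2 \<le> 2 * (cmod z)\<^sup>2 + 2 * (cmod w)\<^sup>2" for z w
  proof -
    have "(cmod (z + w))\<^sup>2 \<le> (cmod z + cmod w)\<^sup>2"
      by (intro power_mono norm_triangle_ineq) simp
    then show ?thesis
      using sum_squares_bound[of "cmod z" "cmod w"] by (simp add: power2_sum)
  qed
  have "integrable M (\<lambda>x. (cmod (f x + g x))\<^sup>2)"
    by (rule Bochner_Integration.integrable_bound
          [where f = "\<lambda>x. 2 * (cmod (f x))\<^sup>2 + 2 * (cmod (g x))\<^sup>2"])
       (use f g bound in \<open>auto simp: L2_integrable_power2\<close>)
  then show ?thesis by (simp add: L2_def)
qed

lemma L2_diff:
  assumes "f \<in> L2 M" "g \<in> L2 M"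
  shows "(\<lambda>x. f x - g x) \<in> L2 M"
  using L2_add[OF assms(1) L2_cmult[OF assms(2), of "-1"]] by simp

lemma L2_indicator_mult:
  assumes "f \<in> L2 M" "A \<in> sets M"
  shows "(\<lambda>x. indicator A x * f x) \<in> L2 M"
proof -
  have [measurable]: "f \<in> borel_measurable M" using assms by (auto intro: L2_measurable)
  note assms(2)[measurable]
  have "integrable M (\<lambda>x. (cmod (indicator A x * f x))\<^sup>2)"
    by (rule Bochner_Integration.integrable_bound[OF L2_integrable_power2[OF assms(1)]])
       (auto simp: indicator_def)
  then show ?thesis by (simp add: L2_def)
qed

lemma inner_L2_cmult_left: "inner_L2 M (\<lambda>x. c * f x) g = c * inner_L2 M f g"
  by (simp add: inner_L2_def mult.assoc)

lemma inner_L2_cmult_right: "inner_L2 M f (\<lambda>x. c * g x) = cnj c * inner_L2 M f g"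
  by (simp add: inner_L2_def mult.left_commute)

text \<open>Multiplication by a real-valued function is self-adjoint; the two integrands agree
  pointwise, hence \<open>f\<close> and \<open>g\<close> may be arbitrary.\<close>

lemma inner_L2_indicator:
  "inner_L2 M (\<lambda>x. indicator A x * f x) g = inner_L2 M f (\<lambda>x. indicator A x * g x)"
  unfolding inner_L2_def by (rule Bochner_Integration.integral_cong) (auto simp: indicator_def)

lemma inner_L2_diff_left:
  assumes "f \<in> L2 M" "g \<in> L2 M" "h \<in> L2 M"
  shows "inner_L2 M (\<lambda>x. f x - g x) h = inner_L2 M f h - inner_L2 M g h"
  using assms by (simp add: inner_L2_def left_diff_distrib L2_integrable_mult_cnj)

lemma inner_L2_cong_AE:
  assumes "f \<in> L2 M" "f' \<in> L2 M" "g \<in> L2 M" "g' \<in> L2 M"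
    and "AE x in M. f x = f' x" "AE x in M. g x = g' x"
  shows "inner_L2 M f g = inner_L2 M f' g'"
proof -
  have [measurable]: "f \<in> borel_measurable M" "f' \<in> borel_measurable M"
      "g \<in> borel_measurable M" "g' \<in> borel_measurable M"
    using assms by (auto intro: L2_measurable)
  show ?thesis
    unfolding inner_L2_def by (rule integral_cong_AE) (use assms(5,6) in auto)
qed

text \<open>The integrand is the squared modulus of \<open>f\<close>, and a nonnegative integrable
  function with integral 0 vanishes almost everywhere.\<close>

lemma inner_L2_self_eq_0_AE:
  assumes "f \<in> L2 M" "inner_L2 M f f = 0"
  shows "AE x in M. f x = 0"
proof -
  have "inner_L2 M f f = complex_of_real (\<integral>x. (cmod (f x))\<^sup>2 \<partial>M)"
    by (simp only: inner_L2_def complex_norm_square[symmetric] integral_complex_of_real)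
  then have "(\<integral>x. (cmod (f x))\<^sup>2 \<partial>M) = 0"
    using assms(2) by simp
  then show ?thesis
    using integral_nonneg_eq_0_iff_AE[OF L2_integrable_power2[OF assms(1)]] by simp
qed

text \<open>Testing against \<open>h = f - g\<close> shows that the difference has norm 0.\<close>

lemma L2_eq_AE_if_inner_eq:
  assumes "f \<in> L2 M" "g \<in> L2 M" and "\<And>h. h \<in> L2 M \<Longrightarrow> inner_L2 M f h = inner_L2 M g h"
  shows "AE x in M. f x = g x"
  using inner_L2_self_eq_0_AE[OF L2_diff[OF assms(1,2)]] assms
  by (simp add: inner_L2_diff_left L2_diff)

lemma unitary_L2_cmult:
  assumes "unitary_L2 M U" "f \<in> L2 M"
  shows "AE x in M. U (\<lambda>y. c * f y) x = c * U f x"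
proof -
  \<comment> \<open>Linearity in \<open>unitary_L2\<close> is stated for two-term combinations, so a
    second term with coefficient 0 is added.\<close>
  have "AE x in M. U (\<lambda>y. c * f y + 0 * f y) x = c * U f x + 0 * U f x"
    using assms unfolding unitary_L2_def by blast
  then show ?thesis by simp
qed

text \<open>Surjectivity of \<open>U\<close> up to null sets guarantees that the choice in
  \<open>inv_L2\<close> has a witness.\<close>

lemma inv_L2:
  assumes "unitary_L2 M U" "h \<in> L2 M"
  shows "inv_L2 M U h \<in> L2 M" "AE x in M. U (inv_L2 M U h) x = h x"
proof -
  have "\<exists>f. f \<in> L2 M \<and> (AE x in M. U f x = h x)"
    using assms unfolding unitary_L2_def by blast
  from someI_ex[OF this] show "inv_L2 M U h \<in> L2 M" "AE x in M. U (inv_L2 M U h) x = h x"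
    by (simp_all add: inv_L2_def)
qed

text \<open>An explicit solution \<open>h\<close> of the weak equation takes the place of a Riesz
  representation argument: it shows that the choice in \<open>P_op\<close> is meaningful, and since
  the inner products determine an element, the chosen function agrees with \<open>h\<close> almost
  everywhere.\<close>

lemma P_op_characterization:
  assumes "h \<in> L2 M"
    and "\<And>g. g \<in> L2 M \<Longrightarrow> inner_L2 M h g =
      inner_L2 M (\<lambda>\<xi>. \<sigma> \<xi> * U (\<lambda>x. \<phi> x * f x) \<xi>) (U (\<lambda>x. \<psi> x * g x))"
  shows "P_op M U \<sigma> \<phi> \<psi> f \<in> L2 M" "AE x in M. P_op M U \<sigma> \<phi> \<psi> f x = h x"
proof -
  have "\<exists>h. h \<in> L2 M \<and> (\<forall>g \<in> L2 M. inner_L2 M h g =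
      inner_L2 M (\<lambda>\<xi>. \<sigma> \<xi> * U (\<lambda>x. \<phi> x * f x) \<xi>) (U (\<lambda>x. \<psi> x * g x)))"
    using assms by blast
  from someI_ex[OF this]
  have P: "P_op M U \<sigma> \<phi> \<psi> f \<in> L2 M \<and> (\<forall>g \<in> L2 M. inner_L2 M (P_op M U \<sigma> \<phi> \<psi> f) g =
      inner_L2 M (\<lambda>\<xi>. \<sigma> \<xi> * U (\<lambda>x. \<phi> x * f x) \<xi>) (U (\<lambda>x. \<psi> x * g x)))"
    by (simp add: P_op_def)
  then show "P_op M U \<sigma> \<phi> \<psi> f \<in> L2 M" by blast
  show "AE x in M. P_op M U \<sigma> \<phi> \<psi> f x = h x"
    by (rule L2_eq_AE_if_inner_eq) (use P assms in auto)
qed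

lemma L_op_in_L2:
  assumes "unitary_L2 M U" "S \<in> sets M" "\<Sigma> \<in> sets M" "f \<in> L2 M"
  shows "L_op M U S \<Sigma> f \<in> L2 M"
proof -
  have "U (E_op S f) \<in> L2 M"
    using assms L2_indicator_mult[OF assms(4,2)] unfolding unitary_L2_def E_op_def by blast
  from inv_L2(1)[OF assms(1) L2_indicator_mult[OF this assms(3)]]
  have "F_op M U \<Sigma> (E_op S f) \<in> L2 M"
    by (simp add: F_op_def)
  from L2_indicator_mult[OF this assms(2)] show ?thesis
    by (simp add: L_op_def E_op_def[abs_def])
qed

text \<open>The outer projection moves onto \<open>g\<close> by self-adjointness. Applying the
  isometry \<open>U\<close> to both arguments then cancels the inverse transform inside
  \<open>F_op\<close>, up to a null set.\<close>

lemma inner_L_op: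
  assumes U: "unitary_L2 M U" and S: "S \<in> sets M" and \<Sigma>: "\<Sigma> \<in> sets M"
    and f: "f \<in> L2 M" and g: "g \<in> L2 M"
  shows "inner_L2 M (L_op M U S \<Sigma> f) g =
    inner_L2 M (\<lambda>\<xi>. indicator \<Sigma> \<xi> * U (E_op S f) \<xi>) (U (E_op S g))"
proof -
  have E: "E_op S k \<in> L2 M" if "k \<in> L2 M" for k
    using L2_indicator_mult[OF that S] by (simp add: E_op_def[abs_def])
  have UE: "U (E_op S k) \<in> L2 M" if "k \<in> L2 M" for k
    using U E[OF that] by (simp add: unitary_L2_def)
  define w where "w = (\<lambda>\<xi>. indicator \<Sigma> \<xi> * U (E_op S f) \<xi>)"
  have w: "w \<in> L2 M"
    unfolding w_def by (rule L2_indicator_mult[OF UE[OF f] \<Sigma>])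
  note v = inv_L2[OF U w]
  have "inner_L2 M (L_op M U S \<Sigma> f) g = inner_L2 M (inv_L2 M U w) (E_op S g)"
    by (simp add: L_op_def F_op_def w_def E_op_def[abs_def] inner_L2_indicator)
  also have "\<dots> = inner_L2 M (U (inv_L2 M U w)) (U (E_op S g))"
    using U v(1) E[OF g] by (simp add: unitary_L2_def)
  also have "\<dots> = inner_L2 M w (U (E_op S g))"
    using U v w UE[OF g] by (intro inner_L2_cong_AE) (auto simp: unitary_L2_def)
  finally show ?thesis by (simp only: w_def)
qed

theorem theorem5p1:
  fixes \<Omega> S \<Sigma> :: "'a::euclidean_space set"
    and \<mu> :: "'a measure"
    and a :: real
    and Q :: "'a \<Rightarrow> real"
    and K :: "'a \<Rightarrow> 'a \<Rightarrow> complex"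
    and \<T> :: "('a \<Rightarrow> complex) \<Rightarrow> 'a \<Rightarrow> complex"
    and \<phi> :: "'a \<Rightarrow> complex"
  assumes "unitary_integral_operator \<Omega> \<mu> a Q K \<T>"
    and "S \<in> sets \<mu>" and "0 < emeasure \<mu> S" and "emeasure \<mu> S < \<infinity>"
    and "\<Sigma> \<in> sets \<mu>" and "0 < emeasure \<mu> \<Sigma>" and "emeasure \<mu> \<Sigma> < \<infinity>"
    and "\<phi> = (\<lambda>x. complex_of_real (1 / sqrt (measure \<mu> S)) * indicator S x)"
  shows "eq_op_L2 \<mu> (L_op \<mu> \<T> S \<Sigma>)
           (\<lambda>f x. complex_of_real (measure \<mu> S) * P_set_op \<mu> \<T> \<Sigma> \<phi> f x)"
  unfolding eq_op_L2_def
proof (intro ballI)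
  fix f assume f: "f \<in> L2 \<mu>"
  have U: "unitary_L2 \<mu> \<T>"
    using assms(1) by (rule unitary_integral_operator.unitary)
  \<comment> \<open>Finiteness matters here: \<open>measure\<close> sends infinite measure to
    0.\<close>
  have m: "measure \<mu> S > 0"
    using assms(3,4) by (simp add: measure_def enn2real_positive_iff)
  define c where "c = complex_of_real (1 / sqrt (measure \<mu> S))"
  have c: "c * cnj c = complex_of_real (1 / measure \<mu> S)"
    using m unfolding c_def complex_cnj_complex_of_real of_real_mult[symmetric] by simp
  have E: "E_op S k \<in> L2 \<mu>" if "k \<in> L2 \<mu>" for k
    using L2_indicator_mult[OF that assms(2)] by (simp add: E_op_def[abs_def])
  have UE: "\<T> (E_op S k) \<in> L2 \<mu>" if "k \<in> L2 \<mu>" for k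
    using U E[OF that] by (simp add: unitary_L2_def)
  have \<phi>: "(\<lambda>x. \<phi> x * k x) = (\<lambda>x. c * E_op S k x)" for k
    by (simp add: assms(8) c_def E_op_def mult.assoc)
  \<comment> \<open>\<open>\<T>\<close> is homogeneous only up to null sets, so \<open>c\<close> can
    be pulled out only almost everywhere.\<close>
  have U\<phi>: "\<T> (\<lambda>x. \<phi> x * k x) \<in> L2 \<mu>" "AE \<xi> in \<mu>. \<T> (\<lambda>x. \<phi> x * k x) \<xi> = c * \<T> (E_op S k) \<xi>"
    if "k \<in> L2 \<mu>" for k
    using U L2_cmult[OF E[OF that]] unitary_L2_cmult[OF U E[OF that]]
    by (simp_all add: \<phi> unitary_L2_def)
  note L = L_op_in_L2[OF U assms(2,5) f]
  \<comment> \<open>The candidate for the value of the weakly defined operator at \<open>f\<close>,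
    obtained by solving the claimed identity for it.\<close>
  define h where "h = (\<lambda>x. complex_of_real (1 / measure \<mu> S) * L_op \<mu> \<T> S \<Sigma> f x)"
  have h: "h \<in> L2 \<mu>"
    unfolding h_def by (rule L2_cmult[OF L])
  have weak: "inner_L2 \<mu> h g =
      inner_L2 \<mu> (\<lambda>\<xi>. indicator \<Sigma> \<xi> * \<T> (\<lambda>x. \<phi> x * f x) \<xi>) (\<T> (\<lambda>x. \<phi> x * g x))"
    if g: "g \<in> L2 \<mu>" for g
  proof -
    \<comment> \<open>The factor \<open>1 / measure \<mu> S\<close> is split as
      \<open>c * cnj c\<close>, so that one \<open>c\<close> can enter each argument of the
      sesquilinear form, matching the two occurrences of \<open>\<phi>\<close>.\<close>
    have "inner_L2 \<mu> h g = c * (cnj c * inner_L2 \<mu> (L_op \<mu> \<T> S \<Sigma> f) g)"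
      unfolding h_def inner_L2_cmult_left c[symmetric] by (rule mult.assoc)
    also have "\<dots> = inner_L2 \<mu> (\<lambda>\<xi>. c * (indicator \<Sigma> \<xi> * \<T> (E_op S f) \<xi>))
        (\<lambda>\<xi>. c * \<T> (E_op S g) \<xi>)"
      by (simp only: inner_L_op[OF U assms(2,5) f g] inner_L2_cmult_left inner_L2_cmult_right)
    also have "\<dots> = inner_L2 \<mu> (\<lambda>\<xi>. indicator \<Sigma> \<xi> * \<T> (\<lambda>x. \<phi> x * f x) \<xi>)
        (\<T> (\<lambda>x. \<phi> x * g x))"
    proof (rule inner_L2_cong_AE)
      show "AE \<xi> in \<mu>. c * (indicator \<Sigma> \<xi> * \<T> (E_op S f) \<xi>) =
          indicator \<Sigma> \<xi> * \<T> (\<lambda>x. \<phi> x * f x) \<xi>"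
        using U\<phi>(2)[OF f] by eventually_elim (simp add: mult.left_commute)
      show "AE \<xi> in \<mu>. c * \<T> (E_op S g) \<xi> = \<T> (\<lambda>x. \<phi> x * g x) \<xi>"
        using U\<phi>(2)[OF g] by eventually_elim simp
    qed (intro L2_cmult[OF L2_indicator_mult[OF UE[OF f] assms(5)]] L2_cmult[OF UE[OF g]]
        L2_indicator_mult[OF U\<phi>(1)[OF f] assms(5)] U\<phi>(1)[OF g])+
    finally show ?thesis .
  qed
  have P: "P_set_op \<mu> \<T> \<Sigma> \<phi> f \<in> L2 \<mu>" "AE x in \<mu>. P_set_op \<mu> \<T> \<Sigma> \<phi> f x = h x"
    using P_op_characterization[OF h weak] by (simp_all add: P_set_op_def)
  have "AE x in \<mu>. L_op \<mu> \<T> S \<Sigma> f x = complex_of_real (measure \<mu> S) * P_set_op \<mu> \<T> \<Sigma> \<phi> f x"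
    using P(2) by eventually_elim (use m in \<open>simp add: h_def\<close>)
  with L L2_cmult[OF P(1)]
  show "L_op \<mu> \<T> S \<Sigma> f \<in> L2 \<mu> \<and>
      (\<lambda>x. complex_of_real (measure \<mu> S) * P_set_op \<mu> \<T> \<Sigma> \<phi> f x) \<in> L2 \<mu> \<and>
      (AE x in \<mu>. L_op \<mu> \<T> S \<Sigma> f x = complex_of_real (measure \<mu> S) * P_set_op \<mu> \<T> \<Sigma> \<phi> f x)"
    by blast
qed

end
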